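(* Let $A$, $B$, $A'$ and $B'$ be pointed closed convex cones in $\mathbb{R}^2$ with non-empty interior and apex the origin $O$, such that $\operatorname{int}A\cap\operatorname{int}B=\emptyset$. The identity $g_{A,B}=g_{A',B'}$ holds true if and only if one of the following alternatives occurs: (1) $\{A,-B\}=\{A',-B'\}$; (2) there exist a linear transformation $\mathcal{T}$ and $i,j\in\{1,2\}$, $i\neq j$, such that $$\{\mathcal{T}A,-\mathcal{T}B\}=\{\mathcal{A}_i,-\mathcal{B}_i\}\quad\text{and}\quad\{\mathcal{T}A',-\mathcal{T}B'\}=\{\mathcal{A}_j,-\mathcal{B}_j\}.$$
   Context: For convex sets $K,L\subset\mathbb{R}^2$, the cross covariogram of $K$ and $L$ is the function $g_{K,L}(x)=\lambda_2(K\cap(L+x))$, where $x\in\mathbb{R}^2$ is such that $\lambda_2(K\cap(L+x))$ is finite; $\lambda_2$ is two-dimensional Lebesgue measure and $\operatorname{int}$ denotes interior. A convex cone is pointed if its apex is a vertex. In polar coordinates $(\rho,\theta)$ in $\mathbb{R}^2$, for $\alpha,\beta\in[0,2\pi]$ with $\alpha<\beta$, $\{\alpha\le\theta\le\beta\}$ denotes the cone $\{(\rho,\theta):\theta\in[\alpha,\beta]\}$. The cones in alternative (2) are $\mathcal{A}_1=\{0\le\theta\le 3\pi/4\}$, $\mathcal{B}_1=-\{\pi/4\le\theta\le\pi/2\}$, $\mathcal{A}_2=\{0\le\theta\le\pi/4\}$, $\mathcal{B}_2=-\{\pi/2\le\theta\le3\pi/4\}$.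
   Formalization: The "only if" direction is stated under the extra hypothesis that A and B meet only in O; if A and B share a boundary ray, g is 0 on a half-plane and infinite elsewhere, so the cones cannot be recovered and the literal claim fails. *)

theory Defs
  imports "HOL-Analysis.Analysis"
begin

text \<open>
  The cross covariogram is a partial function: \<open>cross_covariogram K L x\<close> is \<open>None\<close> where
  the measure of \<open>K \<inter> (L + x)\<close> is infinite. Hence equality of two cross covariograms
  is equality of the domains and of the values on them.
\<close>

definition cross_covariogram :: "(real^2) set \<Rightarrow> (real^2) set \<Rightarrow> real^2 \<rightharpoonup> real" where
  "cross_covariogram K L x =
     (let S = K \<inter> (\<lambda>y. y + x) ` L
      in if emeasure lebesgue S < \<infinity> then Some (measure lebesgue S) else None)"

definition pointed_closed_convex_cone :: "(real^2) set \<Rightarrow> bool" where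
  "pointed_closed_convex_cone S \<longleftrightarrow> convex_cone S \<and> closed S \<and> 0 extreme_point_of S"

definition polar_cone :: "real \<Rightarrow> real \<Rightarrow> (real^2) set" where
  "polar_cone \<alpha> \<beta> = {vector [\<rho> * cos \<theta>, \<rho> * sin \<theta>] | \<rho> \<theta>. 0 \<le> \<rho> \<and> \<alpha> \<le> \<theta> \<and> \<theta> \<le> \<beta>}"

text \<open>The cones \<open>\<A>\<^sub>i\<close> and \<open>\<B>\<^sub>i\<close>; the index is only meaningful for \<open>i \<in> {1, 2}\<close>.\<close>

definition cone_A :: "nat \<Rightarrow> (real^2) set" where
  "cone_A i = (if i = 1 then polar_cone 0 (3 * pi / 4) else polar_cone 0 (pi / 4))"

definition cone_B :: "nat \<Rightarrow> (real^2) set" where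
  "cone_B i = (if i = 1 then uminus ` polar_cone (pi / 4) (pi / 2)
               else uminus ` polar_cone (pi / 2) (3 * pi / 4))"

definition same_up_to_exchange ::
  "(real^2) set \<Rightarrow> (real^2) set \<Rightarrow> (real^2) set \<Rightarrow> (real^2) set \<Rightarrow> bool" where
  "same_up_to_exchange A B A' B' \<longleftrightarrow> {A, uminus ` B} = {A', uminus ` B'}"

text \<open>Invertibility of \<open>T\<close> is not required separately: the equalities force it, since
  \<open>\<A>\<^sub>i\<close> and \<open>-\<B>\<^sub>i\<close> span the plane.\<close>

definition exceptional_pairs ::
  "(real^2) set \<Rightarrow> (real^2) set \<Rightarrow> (real^2) set \<Rightarrow> (real^2) set \<Rightarrow> bool" where
  "exceptional_pairs A B A' B' \<longleftrightarrow>
     (\<exists>T i j. linear T \<and> i \<in> {1, 2} \<and> j \<in> {1, 2} \<and> i \<noteq> j \<and>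
        {T ` A, uminus ` (T ` B)} = {cone_A i, uminus ` cone_B i} \<and>
        {T ` A', uminus ` (T ` B')} = {cone_A j, uminus ` cone_B j})"

end

theory Submission
  imports Defs "HOL-Computational_Algebra.Polynomial" "HOL-Library.Multiset"
begin

text \<open>
  With \<open>C = -B\<close>, the cross covariogram of \<open>A\<close> and \<open>B\<close> is the convolution of the indicator
  functions of \<open>A\<close> and \<open>C\<close> (\<open>overlap\<close>). This is symmetric in \<open>A\<close> and \<open>C\<close>, and an invertible linear
  map of the plane only rescales it. It follows that the identity holds in the first alternative,
  and that the second one reduces to the two model pairs. For these, the two intersections at a
  given point \<open>x\<close> differ by a quarter turn and a translation, so they have the same area
  (\<open>overlap_exceptional\<close>).

  Conversely, let \<open>A \<inter> B = {0}\<close>. Some linear functional is positive on \<open>A\<close> and \<open>C\<close> away from the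
  origin, and since the convolution determines its support, it is also positive on \<open>A'\<close> and \<open>C'\<close>
  (\<open>cone_subset_support\<close>). In suitable coordinates all four cones are therefore spanned by pairs
  of vectors \<open>(1, u)\<close> and \<open>(1, v)\<close> with \<open>u < v\<close>. The Laplace transform of such a cone at \<open>(1, t)\<close> is
  \<open>(v - u) / ((1 + t u) (1 + t v))\<close>, and the transform of a convolution is the product of the
  transforms. Thus the convolution determines the multiset of the four slopes involved, and the
  product of the two slope differences (\<open>slopes_of_overlap\<close>). It remains to see in which ways
  four given slopes can be grouped into two pairs with a given product. By the Pluecker relation
  the grouping is unique, except that for \<open>t1 < t2 < t3 < t4\<close> the groupings \<open>12|34\<close> and \<open>14|23\<close>
  have the same product if the cross ratio has the right value (\<open>pairing_dichotomy\<close>). In this case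
  a linear map takes the four rays to those of the model cones (\<open>slope_cone_to_model\<close>).
\<close>

section \<open>Lebesgue measure and linear maps\<close>

lemma lborel_linear:
  fixes g :: "real^'n::{finite,wellorder} \<Rightarrow> real^'n::_"
  assumes g: "linear g" and d: "det (matrix g) \<noteq> 0"
  shows "lborel = density (distr lborel borel g) (\<lambda>_. ennreal \<bar>det (matrix g)\<bar>)"
proof (rule lborel_eqI)
  have gm: "g \<in> borel_measurable borel"
    by (intro borel_measurable_continuous_onI linear_continuous_on linear_linear[THEN iffD2] g)
  have "inj g" "surj g"
    using d det_nz_iff_inj[OF g] linear_injective_imp_surjective[OF g] by auto
  then obtain g' where g': "linear g'" "g' \<circ> g = id" "g \<circ> g' = id"
    using linear_injective_isomorphism[OF g \<open>inj g\<close>] by (metis comp_def eq_id_iff)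
  fix l u :: "real^'n::_" assume lu: "\<And>b. b \<in> Basis \<Longrightarrow> l \<bullet> b \<le> u \<bullet> b"
  define S where "S = g -` box l u"
  have S: "S = g' ` box l u"
    using g' unfolding S_def by (auto simp: image_iff pointfree_idE) (metis comp_apply id_apply)
  have lm: "S \<in> lmeasurable"
    unfolding S by (rule measurable_linear_image[OF g'(1)]) simp
  have [measurable]: "S \<in> sets borel"
    using measurable_sets[OF gm, of "box l u"] by (simp add: S_def)
  have gS: "g ` S = box l u"
    using \<open>surj g\<close> by (simp add: S_def)
  have "\<bar>det (matrix g)\<bar> * measure lebesgue S = measure lebesgue (box l u)"
    using measure_linear_image[OF g lm] gS by simp
  moreover have "measure lebesgue (box l u) = (\<Prod>b\<in>Basis. (u - l) \<bullet> b)"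
    using lu by (simp add: measure_lborel_box inner_diff_left)
  moreover have "emeasure lborel S = ennreal (measure lebesgue S)"
    using emeasure_eq_measure2[OF lm] by simp
  ultimately show "emeasure (density (distr lborel borel g) (\<lambda>_. ennreal \<bar>det (matrix g)\<bar>)) (box l u)
     = (\<Prod>b\<in>Basis. (u - l) \<bullet> b)"
    using gm by (simp add: emeasure_density nn_integral_cmult emeasure_distr flip: S_def ennreal_mult')
qed simp

text \<open>
  Substitution in nonnegative integrals under an invertible linear map. No integrability of the
  integrand is needed, so infinite values are covered.
\<close>

lemma nn_integral_lborel_linear:
  fixes g :: "real^'n::{finite,wellorder} \<Rightarrow> real^'n::_"
  assumes g: "linear g" and d: "det (matrix g) \<noteq> 0" and [measurable]: "f \<in> borel_measurable borel"
  shows "(\<integral>\<^sup>+x. f x \<partial>lborel) = ennreal \<bar>det (matrix g)\<bar> * (\<integral>\<^sup>+x. f (g x) \<partial>lborel)"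
proof -
  have [measurable]: "g \<in> borel_measurable borel"
    by (intro borel_measurable_continuous_onI linear_continuous_on linear_linear[THEN iffD2] g)
  show ?thesis
    by (subst lborel_linear[OF g d])
      (simp add: nn_integral_density nn_integral_distr nn_integral_cmult)
qed

lemma emeasure_lborel_linear_image:
  fixes g :: "real^'n::{finite,wellorder} \<Rightarrow> real^'n::_"
  assumes g: "linear g" and d: "det (matrix g) \<noteq> 0" and S: "g ` S \<in> sets borel"
  shows "emeasure lborel (g ` S) = ennreal \<bar>det (matrix g)\<bar> * emeasure lborel S"
proof -
  have [measurable]: "g \<in> borel_measurable borel"
    by (intro borel_measurable_continuous_onI linear_continuous_on linear_linear[THEN iffD2] g)
  have inj: "inj g"
    using d det_nz_iff_inj[OF g] by auto
  have [measurable]: "S \<in> sets borel"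
    using measurable_sets[OF _ S, of g borel] inj by (simp add: inj_vimage_image_eq)
  have "emeasure lborel (g ` S) = (\<integral>\<^sup>+x. indicator (g ` S) x \<partial>lborel)"
    using S by simp
  also have "\<dots> = ennreal \<bar>det (matrix g)\<bar> * (\<integral>\<^sup>+x. indicator (g ` S) (g x) \<partial>lborel)"
    using S by (intro nn_integral_lborel_linear g d) simp
  also have "(\<integral>\<^sup>+x. indicator (g ` S) (g x) \<partial>lborel) = (\<integral>\<^sup>+x. indicator S x \<partial>lborel)"
    using inj by (intro nn_integral_cong) (auto simp: indicator_def inj_image_mem_iff)
  finally show ?thesis by simp
qed

lemma nn_integral_lborel_translate:
  fixes c :: "'a::euclidean_space"
  assumes [measurable]: "f \<in> borel_measurable borel"
  shows "(\<integral>\<^sup>+x. f (c + x) \<partial>lborel) = (\<integral>\<^sup>+x. f x \<partial>lborel)"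
  by (subst (2) lborel_distr_plus[of c, symmetric]) (simp add: nn_integral_distr)

lemma nn_integral_exp_Ici:
  fixes p :: real assumes "p > 0"
  shows "(\<integral>\<^sup>+s. ennreal (exp (- (p * s))) * indicator {0..} s \<partial>lborel) = ennreal (1 / p)"
proof -
  have "((\<lambda>s. - exp (- (p * s)) / p) \<longlongrightarrow> - 0 / p) at_top"
    using assms by (intro tendsto_intros filterlim_compose[OF exp_at_bot]
      filterlim_uminus_at_bot_at_top[THEN filterlim_compose]
      filterlim_tendsto_pos_mult_at_top[OF tendsto_const] filterlim_ident) auto
  then have "(\<integral>\<^sup>+s. ennreal (exp (- (p * s))) * indicator {0..} s \<partial>lborel)
      = ennreal (- 0 / p - (- exp (- (p * 0)) / p))"
    using assms by (intro nn_integral_FTC_atLeast) (auto intro!: derivative_eq_intros)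
  then show ?thesis by simp
qed

lemma nn_integral_exp_quadrant:
  fixes p q :: real assumes "p > 0" "q > 0"
  shows "(\<integral>\<^sup>+x. ennreal (exp (- (p * x$1 + q * x$2))) * indicator {x::real^2. 0 \<le> x$1 \<and> 0 \<le> x$2} x \<partial>lborel)
     = ennreal (1 / (p * q))"
proof -
  have B: "(Basis :: (real^2) set) = {axis 1 1, axis 2 1}"
    by (auto simp: Basis_vec_def UNIV_2)
  have ne: "axis 1 1 \<noteq> (axis 2 1 :: real^2)" by (simp add: axis_eq_axis)
  define f where "f b s = ennreal (exp (- ((if b = axis 1 1 then p else q) * s))) * indicator {0..} s"
    for b :: "real^2" and s :: real
  have "(\<integral>\<^sup>+x. (\<Prod>b\<in>Basis. f b (x \<bullet> b)) \<partial>lborel) = (\<Prod>b\<in>Basis. (\<integral>\<^sup>+x. f b x \<partial>lborel))"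
    by (rule nn_integral_lborel_prod) (simp_all add: f_def)
  also have "\<dots> = ennreal (1 / (p * q))"
    using assms ne by (simp add: B f_def nn_integral_exp_Ici flip: ennreal_mult')
  also have "(\<lambda>x. \<Prod>b\<in>Basis. f b (x \<bullet> b))
     = (\<lambda>x. ennreal (exp (- (p * x$1 + q * x$2))) * indicator {x::real^2. 0 \<le> x$1 \<and> 0 \<le> x$2} x)"
    using ne by (auto simp: B f_def inner_axis indicator_def exp_add fun_eq_iff
        exp_minus exp_diff divide_inverse simp flip: ennreal_mult')
  finally show ?thesis .
qed

text \<open>
  The linear map of the plane with matrix rows \<open>(a, b)\<close> and \<open>(c, d)\<close>.
\<close>

definition plane_map :: "real \<Rightarrow> real \<Rightarrow> real \<Rightarrow> real \<Rightarrow> real^2 \<Rightarrow> real^2" where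
  "plane_map a b c d x = vector [a * x$1 + b * x$2, c * x$1 + d * x$2]"

lemma plane_map_nth [simp]:
  "plane_map a b c d x $ 1 = a * x$1 + b * x$2" "plane_map a b c d x $ 2 = c * x$1 + d * x$2"
  by (simp_all add: plane_map_def)

lemma linear_plane_map: "linear (plane_map a b c d)"
  by (rule linearI) (simp_all add: vec_eq_iff forall_2 algebra_simps)

lemma det_plane_map: "det (matrix (plane_map a b c d)) = a * d - b * c"
  by (simp add: det_2 matrix_def axis_def)

section \<open>The convolution of two indicator functions\<close>

text \<open>
  The volume of the intersection of \<open>A\<close> with the reflected translate \<open>x - C\<close>, that is, the
  convolution of the indicator functions of \<open>A\<close> and \<open>C\<close>. For \<open>C = -B\<close> this is the cross covariogram
  of \<open>A\<close> and \<open>B\<close>, but as a total function with values in \<open>[0, \<infinity>]\<close>, and in a form that is symmetric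
  in its two arguments.
\<close>

definition overlap :: "'a::euclidean_space set \<Rightarrow> 'a set \<Rightarrow> 'a \<Rightarrow> ennreal" where
  "overlap A C x = emeasure lborel {y. y \<in> A \<and> x - y \<in> C}"

lemma sets_overlap:
  fixes A C :: "'a::euclidean_space set"
  assumes [measurable]: "A \<in> sets borel" "C \<in> sets borel"
  shows "{y. y \<in> A \<and> x - y \<in> C} \<in> sets borel"
  by measurable

lemma overlap_commute:
  fixes A C :: "'a::euclidean_space set"
  assumes [measurable]: "A \<in> sets borel" "C \<in> sets borel"
  shows "overlap A C = overlap C A"
proof
  fix x :: 'a
  have refl: "lborel = distr lborel borel (\<lambda>y::'a. x - y)"
    by (subst lborel_affine[of "-1" x]) (auto simp: density_1)
  have "overlap A C x = emeasure (distr lborel borel (\<lambda>y. x - y)) {y. y \<in> A \<and> x - y \<in> C}"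
    unfolding overlap_def by (subst refl) simp
  also have "\<dots> = emeasure lborel ((\<lambda>y. x - y) -` {y. y \<in> A \<and> x - y \<in> C})"
    by (subst emeasure_distr) auto
  also have "(\<lambda>y. x - y) -` {y. y \<in> A \<and> x - y \<in> C} = {y. y \<in> C \<and> x - y \<in> A}"
    by auto
  finally show "overlap A C x = overlap C A x"
    by (simp add: overlap_def)
qed

lemma overlap_doubleton:
  assumes "{A, C} = {A', C'}" "A \<in> sets borel" "C \<in> sets borel"
  shows "overlap A C = overlap A' C'"
  using assms overlap_commute by (auto simp: doubleton_eq_iff)

text \<open>
  Equality of the partial functions, domains included, is equality of the \<open>[0, \<infinity>]\<close>-valued
  convolutions.
\<close>

lemma cross_covariogram_eq_iff:
  assumes A: "A \<in> sets borel" "A' \<in> sets borel"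
    and B: "uminus ` B \<in> sets borel" "uminus ` B' \<in> sets borel"
  shows "cross_covariogram A B = cross_covariogram A' B' \<longleftrightarrow>
    overlap A (uminus ` B) = overlap A' (uminus ` B')"
proof -
  have cc: "cross_covariogram A B x =
      (if overlap A (uminus ` B) x < \<infinity> then Some (enn2real (overlap A (uminus ` B) x)) else None)"
    if AB: "A \<in> sets borel" "uminus ` B \<in> sets borel" for A B :: "(real^2) set" and x
  proof -
    have "A \<inter> (\<lambda>y. y + x) ` B = {y. y \<in> A \<and> x - y \<in> uminus ` B}"
      by (auto simp: image_iff)
        (metis add.commute add_diff_cancel_right' minus_diff_eq diff_add_cancel neg_equal_iff_equal)+
    then show ?thesis
      using sets_overlap[OF AB, of x]
      by (simp add: cross_covariogram_def overlap_def measure_def Let_def)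
  qed
  have "(if a < \<infinity> then Some (enn2real a) else None) = (if b < \<infinity> then Some (enn2real b) else None)
     \<longleftrightarrow> a = b" for a b :: ennreal
    by (cases a; cases b) (auto simp: less_top)
  then show ?thesis
    by (simp add: fun_eq_iff cc A B)
qed

lemma overlap_linear_image:
  fixes g :: "real^'n::{finite,wellorder} \<Rightarrow> real^'n::_"
  assumes g: "linear g" and d: "det (matrix g) \<noteq> 0"
    and A: "g ` A \<in> sets borel" and C: "g ` C \<in> sets borel"
  shows "overlap (g ` A) (g ` C) (g x) = ennreal \<bar>det (matrix g)\<bar> * overlap A C x"
proof -
  have inj: "inj g" and surj: "surj g"
    using d det_nz_iff_inj[OF g] linear_injective_imp_surjective[OF g] by auto
  have "{y. y \<in> g ` A \<and> g x - y \<in> g ` C} = g ` {y. y \<in> A \<and> x - y \<in> C}"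
  proof -
    have "g x - g a \<in> g ` C \<longleftrightarrow> x - a \<in> C" for a
      by (simp add: inj_image_mem_iff[OF inj] flip: linear_diff[OF g])
    then show ?thesis by auto
  qed
  then show ?thesis
    unfolding overlap_def using sets_overlap[OF A C, of "g x"]
    by (simp add: emeasure_lborel_linear_image[OF g d])
qed

lemma overlap_linear_image_eq_iff:
  fixes g :: "real^'n::{finite,wellorder} \<Rightarrow> real^'n::_"
  assumes g: "linear g" and d: "det (matrix g) \<noteq> 0"
    and "g ` A \<in> sets borel" "g ` C \<in> sets borel" "g ` A' \<in> sets borel" "g ` C' \<in> sets borel"
  shows "overlap (g ` A) (g ` C) = overlap (g ` A') (g ` C') \<longleftrightarrow> overlap A C = overlap A' C'"
proof -
  have "surj g"
    using d det_nz_iff_inj[OF g] linear_injective_imp_surjective[OF g] by auto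
  then have "overlap (g ` A) (g ` C) = overlap (g ` A') (g ` C') \<longleftrightarrow>
      (\<forall>x. overlap (g ` A) (g ` C) (g x) = overlap (g ` A') (g ` C') (g x))"
    by (metis ext surjD)
  also have "\<dots> \<longleftrightarrow> overlap A C = overlap A' C'"
    using d by (simp add: overlap_linear_image assms fun_eq_iff ennreal_mult_cancel_left)
  finally show ?thesis .
qed

text \<open>
  A multiplicative weight turns the convolution into a product. With exponential weights this is
  the convolution theorem for the Laplace transform.
\<close>

lemma nn_integral_overlap:
  fixes e :: "'a::euclidean_space \<Rightarrow> ennreal"
  assumes [measurable]: "A \<in> sets borel" "C \<in> sets borel" "e \<in> borel_measurable borel"
    and mult: "\<And>x y. e (x + y) = e x * e y"
  shows "(\<integral>\<^sup>+x. e x * overlap A C x \<partial>lborel)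
     = (\<integral>\<^sup>+x. e x * indicator A x \<partial>lborel) * (\<integral>\<^sup>+x. e x * indicator C x \<partial>lborel)"
proof -
  have "(\<integral>\<^sup>+x. e x * overlap A C x \<partial>lborel)
      = (\<integral>\<^sup>+x. (\<integral>\<^sup>+y. e x * (indicator A y * indicator C (x - y)) \<partial>lborel) \<partial>lborel)"
  proof (rule nn_integral_cong)
    fix x
    have "overlap A C x = (\<integral>\<^sup>+y. indicator {y. y \<in> A \<and> x - y \<in> C} y \<partial>lborel)"
      unfolding overlap_def by simp
    also have "\<dots> = (\<integral>\<^sup>+y. indicator A y * indicator C (x - y) \<partial>lborel)"
      by (intro nn_integral_cong) (auto simp: indicator_def)
    finally show "e x * overlap A C x = (\<integral>\<^sup>+y. e x * (indicator A y * indicator C (x - y)) \<partial>lborel)"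
      by (simp add: nn_integral_cmult)
  qed
  also have "\<dots> = (\<integral>\<^sup>+y. (\<integral>\<^sup>+x. e x * (indicator A y * indicator C (x - y)) \<partial>lborel) \<partial>lborel)"
    by (rule lborel_pair.Fubini') measurable
  also have "\<dots> = (\<integral>\<^sup>+y. (e y * indicator A y) * (\<integral>\<^sup>+z. e z * indicator C z \<partial>lborel) \<partial>lborel)"
  proof (rule nn_integral_cong)
    fix y
    have "(\<integral>\<^sup>+x. e x * (indicator A y * indicator C (x - y)) \<partial>lborel)
       = (\<integral>\<^sup>+z. e (y + z) * (indicator A y * indicator C (y + z - y)) \<partial>lborel)"
      by (rule nn_integral_lborel_translate[symmetric]) measurable
    also have "\<dots> = (\<integral>\<^sup>+z. (e y * indicator A y) * (e z * indicator C z) \<partial>lborel)"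
      by (intro nn_integral_cong) (simp add: mult mult_ac)
    finally show "(\<integral>\<^sup>+x. e x * (indicator A y * indicator C (x - y)) \<partial>lborel)
       = (e y * indicator A y) * (\<integral>\<^sup>+z. e z * indicator C z \<partial>lborel)"
      by (simp add: nn_integral_cmult)
  qed
  also have "\<dots> = (\<integral>\<^sup>+x. e x * indicator A x \<partial>lborel) * (\<integral>\<^sup>+x. e x * indicator C x \<partial>lborel)"
    by (simp add: nn_integral_multc)
  finally show ?thesis .
qed

lemma overlap_pos:
  fixes A C :: "'a::euclidean_space set"
  assumes [measurable]: "A \<in> sets borel" "C \<in> sets borel"
    and x: "x \<in> interior A" and C: "convex_cone C" "interior C \<noteq> {}"
  shows "overlap A C x > 0"
proof -
  \<comment> \<open>Moving from \<open>x\<close> a little against an interior direction of \<open>C\<close> stays inside \<open>A\<close>.\<close>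
  obtain c where c: "c \<in> interior C" using C by auto
  have "((\<lambda>t. x - t *\<^sub>R c) \<longlongrightarrow> x - 0 *\<^sub>R c) (at_right 0)"
    by (intro tendsto_intros)
  then have "\<forall>\<^sub>F t in at_right 0. x - t *\<^sub>R c \<in> interior A"
    by (rule topological_tendstoD) (use x in auto)
  moreover have "\<forall>\<^sub>F t in at_right (0::real). t > 0"
    by (rule eventually_at_right_less)
  ultimately have "\<forall>\<^sub>F t in at_right (0::real). t > 0 \<and> x - t *\<^sub>R c \<in> interior A"
    by eventually_elim auto
  then obtain t where t: "t > 0" "x - t *\<^sub>R c \<in> interior A"
    using eventually_happens'[OF trivial_limit_at_right_real] by blast
  define U where "U = interior A \<inter> (\<lambda>y. (1/t) *\<^sub>R (x - y)) -` interior C"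
  have "open U"
    unfolding U_def by (intro open_Int open_interior open_vimage continuous_intros)
  moreover have "x - t *\<^sub>R c \<in> U"
    using t c by (simp add: U_def)
  ultimately have U0: "emeasure lborel U \<noteq> 0"
    using open_not_negligible[of U] by (auto simp: negligible_iff_null_sets null_sets_def)
  have "U \<subseteq> {y. y \<in> A \<and> x - y \<in> C}"
  proof
    fix y assume y: "y \<in> U"
    then have "(1/t) *\<^sub>R (x - y) \<in> C" "y \<in> A"
      using interior_subset by (auto simp: U_def)
    then have "t *\<^sub>R ((1/t) *\<^sub>R (x - y)) \<in> C"
      using t C by (metis convex_cone_scaleR less_imp_le)
    then show "y \<in> {y. y \<in> A \<and> x - y \<in> C}"
      using t \<open>y \<in> A\<close> by simp
  qed
  then have "emeasure lborel U \<le> overlap A C x"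
    unfolding overlap_def using sets_overlap[OF assms(1,2), of x] by (intro emeasure_mono) auto
  then show ?thesis
    using U0 by (metis le_zero_eq not_gr_zero)
qed

section \<open>The exceptional pairs\<close>

text \<open>
  A sector of opening less than \<open>pi\<close> is the intersection of two half planes.
\<close>

lemma polar_cone_eq:
  assumes "\<alpha> < \<beta>" "\<beta> < \<alpha> + pi"
  shows "polar_cone \<alpha> \<beta> =
    {x. 0 \<le> cos \<alpha> * x$2 - sin \<alpha> * x$1 \<and> 0 \<le> sin \<beta> * x$1 - cos \<beta> * x$2}" (is "_ = ?H")
proof (intro equalityI subsetI)
  fix x assume "x \<in> polar_cone \<alpha> \<beta>"
  then obtain \<rho> \<theta> where x: "x = vector [\<rho> * cos \<theta>, \<rho> * sin \<theta>]" "0 \<le> \<rho>" "\<alpha> \<le> \<theta>" "\<theta> \<le> \<beta>"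
    by (auto simp: polar_cone_def)
  then have "0 \<le> \<rho> * sin (\<theta> - \<alpha>)" "0 \<le> \<rho> * sin (\<beta> - \<theta>)"
    using assms by (auto intro!: mult_nonneg_nonneg sin_ge_zero)
  then show "x \<in> ?H"
    by (simp add: x(1) sin_diff algebra_simps)
next
  fix x assume H: "x \<in> ?H"
  show "x \<in> polar_cone \<alpha> \<beta>"
  proof (cases "x = 0")
    case True
    then have "x = vector [0 * cos \<alpha>, 0 * sin \<alpha>]" by (simp add: vec_eq_iff forall_2)
    then show ?thesis
      using assms unfolding polar_cone_def by (intro CollectI exI[of _ 0] exI[of _ \<alpha>]) auto
  next
    case False
    define \<rho> where "\<rho> = sqrt ((x$1)\<^sup>2 + (x$2)\<^sup>2)"
    have \<rho>2: "\<rho>\<^sup>2 = (x$1)\<^sup>2 + (x$2)\<^sup>2" by (simp add: \<rho>_def)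
    have \<rho>: "\<rho> > 0"
      using False by (simp add: \<rho>_def vec_eq_iff forall_2 sum_power2_gt_zero_iff)
    define c s where "c = (cos \<alpha> * x$1 + sin \<alpha> * x$2) / \<rho>" and "s = (cos \<alpha> * x$2 - sin \<alpha> * x$1) / \<rho>"
    have cs: "(cos \<alpha>)\<^sup>2 + (sin \<alpha>)\<^sup>2 = 1" by simp
    have "(cos \<alpha> * x$1 + sin \<alpha> * x$2)\<^sup>2 + (cos \<alpha> * x$2 - sin \<alpha> * x$1)\<^sup>2
        = ((cos \<alpha>)\<^sup>2 + (sin \<alpha>)\<^sup>2) * \<rho>\<^sup>2"
      unfolding \<rho>2 by algebra
    then have "c\<^sup>2 + s\<^sup>2 = 1"
      using \<rho> cs by (simp add: c_def s_def power_divide flip: add_divide_distrib)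
    moreover have "0 \<le> s" using H \<rho> by (simp add: s_def)
    ultimately obtain t where t: "0 \<le> t" "t \<le> pi" "c = cos t" "s = sin t"
      using sincos_total_pi by blast
    have x1: "x$1 = \<rho> * cos (\<alpha> + t)" and x2: "x$2 = \<rho> * sin (\<alpha> + t)"
    proof -
      have "\<rho> * c = cos \<alpha> * x$1 + sin \<alpha> * x$2" "\<rho> * s = cos \<alpha> * x$2 - sin \<alpha> * x$1"
        using \<rho> by (simp_all add: c_def s_def)
      then show "x$1 = \<rho> * cos (\<alpha> + t)" "x$2 = \<rho> * sin (\<alpha> + t)"
        unfolding cos_add sin_add t(3,4)[symmetric] using cs by algebra+
    qed
    have "0 \<le> \<rho> * sin (\<beta> - (\<alpha> + t))"
      using H unfolding x1 x2 sin_diff by (simp add: x1 x2 algebra_simps)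
    then have "0 \<le> sin (\<beta> - (\<alpha> + t))" using \<rho> by (simp add: zero_le_mult_iff)
    then have "\<not> \<beta> < \<alpha> + t"
      using assms t sin_gt_zero[of "\<alpha> + t - \<beta>"] sin_minus[of "\<alpha> + t - \<beta>"] by (auto simp del: sin_minus)
    then have "\<alpha> + t \<le> \<beta>" by simp
    moreover have "x = vector [\<rho> * cos (\<alpha> + t), \<rho> * sin (\<alpha> + t)]"
      using x1 x2 by (simp add: vec_eq_iff forall_2)
    ultimately show ?thesis
      unfolding polar_cone_def using \<rho> t by (intro CollectI exI[of _ \<rho>] exI[of _ "\<alpha> + t"]) auto
  qed
qed

lemma sincos_135: "sin (3 * pi / 4) = sqrt 2 / 2" "cos (3 * pi / 4) = - (sqrt 2 / 2)"
  using sin_pi_minus[of "pi / 4"] cos_pi_minus[of "pi / 4"] by (simp_all add: sin_45 cos_45)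

lemma polar_cone_instances:
  "polar_cone 0 (3 * pi / 4) = {x. 0 \<le> x$2 \<and> 0 \<le> x$1 + x$2}"
  "polar_cone (pi / 4) (pi / 2) = {x. 0 \<le> x$1 \<and> x$1 \<le> x$2}"
  "polar_cone 0 (pi / 4) = {x. 0 \<le> x$2 \<and> x$2 \<le> x$1}"
  "polar_cone (pi / 2) (3 * pi / 4) = {x. x$1 \<le> 0 \<and> 0 \<le> x$1 + x$2}"
proof -
  have r: "sqrt 2 / 2 * a + sqrt 2 / 2 * b = sqrt 2 / 2 * (a + b)"
          "sqrt 2 / 2 * a - sqrt 2 / 2 * b = sqrt 2 / 2 * (a - b)"
          "sqrt 2 / 2 * a - (- (sqrt 2 / 2)) * b = sqrt 2 / 2 * (a + b)" for a b :: real
    by (simp_all add: algebra_simps)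
  have z: "0 \<le> sqrt 2 / 2 * a \<longleftrightarrow> (0::real) \<le> a" for a
    by (simp add: zero_le_mult_iff)
  have p: "0 < 3 * pi / 4" "3 * pi / 4 < 0 + pi" "pi / 4 < pi / 2" "pi / 2 < pi / 4 + pi"
      "0 < pi / 4" "pi / 4 < 0 + pi" "pi / 2 < 3 * pi / 4" "3 * pi / 4 < pi / 2 + pi"
    using pi_gt_zero by linarith+
  show "polar_cone 0 (3 * pi / 4) = {x. 0 \<le> x$2 \<and> 0 \<le> x$1 + x$2}"
    unfolding polar_cone_eq[OF p(1,2)] sincos_135 r z by simp
  show "polar_cone (pi / 4) (pi / 2) = {x. 0 \<le> x$1 \<and> x$1 \<le> x$2}"
    unfolding polar_cone_eq[OF p(3,4)] sin_45 cos_45 r z by auto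
  show "polar_cone 0 (pi / 4) = {x. 0 \<le> x$2 \<and> x$2 \<le> x$1}"
    unfolding polar_cone_eq[OF p(5,6)] sin_45 cos_45 r z by simp
  show "polar_cone (pi / 2) (3 * pi / 4) = {x. x$1 \<le> 0 \<and> 0 \<le> x$1 + x$2}"
    unfolding polar_cone_eq[OF p(7,8)] sincos_135 r z by simp
qed

lemma cone_AB:
  "cone_A 1 = {x. 0 \<le> x$2 \<and> 0 \<le> x$1 + x$2}"
  "uminus ` cone_B 1 = {x. 0 \<le> x$1 \<and> x$1 \<le> x$2}"
  "cone_A 2 = {x. 0 \<le> x$2 \<and> x$2 \<le> x$1}"
  "uminus ` cone_B 2 = {x. x$1 \<le> 0 \<and> 0 \<le> x$1 + x$2}"
  by (simp_all only: cone_A_def cone_B_def polar_cone_instances) (simp_all add: image_image)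

lemma borel_cone_AB:
  assumes "i \<in> {1, 2}"
  shows "cone_A i \<in> sets borel" "uminus ` cone_B i \<in> sets borel"
proof -
  have "closed (cone_A 1)" "closed (uminus ` cone_B 1)" "closed (cone_A 2)" "closed (uminus ` cone_B 2)"
    unfolding cone_AB by (intro closed_Collect_conj closed_Collect_le continuous_intros)+
  then show "cone_A i \<in> sets borel" "uminus ` cone_B i \<in> sets borel"
    using assms borel_closed by auto
qed

text \<open>
  At every \<open>x\<close> the two intersections are congruent: a quarter turn followed by a translation, both
  explicit, maps the second one onto the first.
\<close>

lemma overlap_exceptional:
  "overlap (cone_A 1) (uminus ` cone_B 1) = overlap (cone_A 2) (uminus ` cone_B 2)"
proof
  fix x :: "real^2"
  define R where "R i = {y. y \<in> cone_A i \<and> x - y \<in> uminus ` cone_B i}" for i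
  let ?g = "plane_map 0 (-1) 1 0"
  define c :: "real^2" where "c = vector [x$1, - x$1]"
  have R1 [measurable]: "R 1 \<in> sets borel"
    unfolding R_def by (intro sets_overlap borel_cone_AB) simp_all
  have "y \<in> R 2 \<longleftrightarrow> c + ?g y \<in> R 1" for y
    unfolding R_def mem_Collect_eq cone_AB by (auto simp: c_def)
  moreover have "surj ?g"
    using linear_injective_imp_surjective[OF linear_plane_map] det_nz_iff_inj[OF linear_plane_map]
    by (metis det_plane_map add.inverse_inverse diff_0 mult_1 mult_zero_left one_neq_zero mult_minus_left)
  ultimately have im: "?g ` R 2 = (+) c -` R 1"
    by (auto simp: image_iff) (metis surjD)
  have meas: "(+) c -` R 1 \<in> sets borel"
    using measurable_sets[of "(+) c" borel borel "R 1"] R1 by simp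
  have "emeasure lborel (R 1) = emeasure (distr lborel borel ((+) c)) (R 1)"
    by (simp add: lborel_distr_plus)
  also have "\<dots> = emeasure lborel ((+) c -` R 1)"
    by (subst emeasure_distr) (use R1 in auto)
  also have "\<dots> = emeasure lborel (R 2)"
    using meas unfolding im[symmetric]
    by (subst emeasure_lborel_linear_image[OF linear_plane_map]) (simp_all add: det_plane_map)
  finally show "overlap (cone_A 1) (uminus ` cone_B 1) x = overlap (cone_A 2) (uminus ` cone_B 2) x"
    by (simp add: overlap_def R_def)
qed

text \<open>
  The map \<open>T\<close> is not assumed invertible; it is so because its range contains a cone with interior.
\<close>

lemma overlap_eq_if_exceptional:
  fixes A C A' C' :: "(real^2) set"
  assumes T: "linear T" and ij: "i \<in> {1, 2}" "j \<in> {1, 2}" "i \<noteq> j"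
    and i: "{T ` A, T ` C} = {cone_A i, uminus ` cone_B i}"
    and j: "{T ` A', T ` C'} = {cone_A j, uminus ` cone_B j}"
  shows "overlap A C = overlap A' C'"
proof -
  have "cone_A i \<subseteq> range T" using i by (metis insertI1 insertE singletonD image_mono subset_UNIV)
  moreover have "cone_A 2 \<subseteq> cone_A i" using ij(1) cone_AB by (auto simp del: One_nat_def)
  ultimately have "vector [1, 0] \<in> range T" "vector [1, 1] \<in> range T"
    by (auto simp: cone_AB subset_iff)
  moreover have "subspace (range T)" by (rule linear_subspace_image[OF T subspace_UNIV])
  ultimately have "(y$1 - y$2) *\<^sub>R vector [1, 0] + y$2 *\<^sub>R vector [1, 1] \<in> range T" for y :: "real^2"
    by (intro subspace_add subspace_scale)
  moreover have "(y$1 - y$2) *\<^sub>R vector [1, 0] + y$2 *\<^sub>R vector [1, 1] = y" for y :: "real^2"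
    by (simp add: vec_eq_iff forall_2)
  ultimately have "surj T" by auto
  then have d: "det (matrix T) \<noteq> 0"
    using linear_surjective_imp_injective[OF T] det_nz_iff_inj[OF T] by auto
  have b: "T ` A \<in> sets borel" "T ` C \<in> sets borel" "T ` A' \<in> sets borel" "T ` C' \<in> sets borel"
    using i j borel_cone_AB[OF ij(1)] borel_cone_AB[OF ij(2)] by (auto simp: doubleton_eq_iff)
  have "overlap (T ` A) (T ` C) = overlap (cone_A i) (uminus ` cone_B i)"
    by (rule overlap_doubleton[OF i b(1,2)])
  also have "\<dots> = overlap (cone_A j) (uminus ` cone_B j)"
    using ij overlap_exceptional by auto
  also have "\<dots> = overlap (T ` A') (T ` C')"
    by (rule overlap_doubleton[OF j b(3,4), symmetric])
  finally show ?thesis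
    by (simp add: overlap_linear_image_eq_iff[OF T d b])
qed

section \<open>Laplace transforms of planar cones\<close>

text \<open>
  For \<open>a < b\<close> this is the cone spanned by \<open>(1, a)\<close> and \<open>(1, b)\<close>: the two inequalities then force
  the first coordinate to be nonnegative.
\<close>

definition slope_cone :: "real \<Rightarrow> real \<Rightarrow> (real^2) set" where
  "slope_cone a b = {x. a * x$1 \<le> x$2 \<and> x$2 \<le> b * x$1}"

lemma borel_slope_cone [measurable]: "slope_cone a b \<in> sets borel"
  unfolding slope_cone_def
  by (intro borel_closed closed_Collect_conj closed_Collect_le continuous_intros)

text \<open>
  The Laplace transform of a slope cone, at a point where it is finite.
\<close>

lemma nn_integral_exp_slope_cone:
  assumes ab: "a < b" and pos: "p + q * a > 0" "p + q * b > 0"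
  shows "(\<integral>\<^sup>+x. ennreal (exp (- (p * x$1 + q * x$2))) * indicator (slope_cone a b) x \<partial>lborel)
     = ennreal ((b - a) / ((p + q * a) * (p + q * b)))"
proof -
  \<comment> \<open>This map takes the positive quadrant onto the cone.\<close>
  let ?g = "plane_map 1 1 a b" and ?Q = "{x::real^2. 0 \<le> x$1 \<and> 0 \<le> x$2}"
  have d: "det (matrix ?g) = b - a" by (simp add: det_plane_map)
  have mem: "?g x \<in> slope_cone a b \<longleftrightarrow> 0 \<le> x$1 \<and> 0 \<le> x$2" for x
  proof -
    have "?g x \<in> slope_cone a b \<longleftrightarrow> 0 \<le> (b - a) * x$2 \<and> 0 \<le> (b - a) * x$1"
      by (auto simp: slope_cone_def algebra_simps)
    then show ?thesis using ab by (auto simp: zero_le_mult_iff)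
  qed
  have "(\<integral>\<^sup>+x. ennreal (exp (- (p * x$1 + q * x$2))) * indicator (slope_cone a b) x \<partial>lborel)
     = ennreal (b - a) * (\<integral>\<^sup>+x. ennreal (exp (- (p * ?g x$1 + q * ?g x$2))) * indicator (slope_cone a b) (?g x) \<partial>lborel)"
    using ab d by (subst nn_integral_lborel_linear[OF linear_plane_map, of 1 1 a b]) auto
  also have "(\<lambda>x. ennreal (exp (- (p * ?g x$1 + q * ?g x$2))) * indicator (slope_cone a b) (?g x))
    = (\<lambda>x. ennreal (exp (- ((p + q * a) * x$1 + (p + q * b) * x$2))) * indicator ?Q x)"
    by (auto simp: fun_eq_iff mem indicator_def algebra_simps)
  also have "ennreal (b - a) * (\<integral>\<^sup>+x. ennreal (exp (- ((p + q * a) * x$1 + (p + q * b) * x$2))) * indicator ?Q x \<partial>lborel)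
    = ennreal ((b - a) / ((p + q * a) * (p + q * b)))"
    unfolding nn_integral_exp_quadrant[OF pos] using ab by (simp flip: ennreal_mult')
  finally show ?thesis .
qed

text \<open>
  The product of the factors \<open>1 + t u\<close>, known for small \<open>t\<close>, determines the multiset of the \<open>u\<close>,
  since in the variable \<open>1 / t\<close>, and up to a power of \<open>t\<close>, it is the monic polynomial with roots
  \<open>- u\<close>. Zero members \<open>u\<close> do not
  show up in the product; hence the assumption that the multisets have equal size.
\<close>

lemma mset_eqI_prod_linear:
  fixes M N :: "real multiset"
  assumes "size M = size N" and e: "e > 0"
    and eq: "\<And>t. \<bar>t\<bar> < e \<Longrightarrow> (\<Prod>u\<in>#M. 1 + t * u) = (\<Prod>u\<in>#N. 1 + t * u)"
  shows "M = N"
proof -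
  define P where "P M = (\<Prod>u\<in>#M. [:u, 1:])" for M :: "real multiset"
  have poly_P: "poly (P M) (1 / t) * t ^ size M = (\<Prod>u\<in>#M. 1 + t * u)" if "t \<noteq> 0" for t M
    using that by (induction M) (simp_all add: P_def field_simps)
  have proots_P: "proots (P M) = image_mset uminus M" for M
  proof (induction M)
    case (add u M)
    have "P M \<noteq> 0" by (auto simp: P_def prod_mset_zero_iff)
    then have "proots ([:u, 1:] * P M) = {#- u#} + proots (P M)"
      by (subst proots_mult) auto
    with add show ?case by (simp add: P_def del: mult_pCons_left)
  qed (simp add: P_def)
  have "poly (P M - P N) s = 0" if "s > 1 / e" for s
  proof -
    have "s > 0" using e that by (meson divide_pos_pos less_trans zero_less_one)
    then have "poly (P M) s * (1 / s) ^ size M = poly (P N) s * (1 / s) ^ size N"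
      using eq[of "1 / s"] that e poly_P[of "1 / s"] by (simp add: field_simps)
    then show ?thesis using assms(1) \<open>s > 0\<close> by simp
  qed
  then have "{1 / e<..} \<subseteq> {s. poly (P M - P N) s = 0}" by auto
  then have "infinite {s. poly (P M - P N) s = 0}"
    using infinite_Ioi infinite_super by blast
  then have "P M = P N" using poly_roots_finite[of "P M - P N"] by auto
  then have "image_mset uminus M = image_mset uminus N" using proots_P by metis
  then show ?thesis by (meson inj_uminus injD multiset.inj_map)
qed

text \<open>
  Comparing Laplace transforms at the points \<open>(1, t)\<close> with \<open>t\<close> small: the poles give the four
  slopes, and the value at \<open>t = 0\<close> gives the product of the two differences.
\<close>

lemma slopes_of_overlap:
  assumes less: "a < b" "c < d" "a' < b'" "c' < d'"
    and eq: "overlap (slope_cone a b) (slope_cone c d) = overlap (slope_cone a' b') (slope_cone c' d')"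
  shows "(b - a) * (d - c) = (b' - a') * (d' - c') \<and> {#a, b, c, d#} = {#a', b', c', d'#}"
proof -
  define R where "R = \<bar>a\<bar> + \<bar>b\<bar> + \<bar>c\<bar> + \<bar>d\<bar> + \<bar>a'\<bar> + \<bar>b'\<bar> + \<bar>c'\<bar> + \<bar>d'\<bar>"
  \<comment> \<open>For \<open>\<bar>t\<bar> < r\<close> all factors \<open>1 + t u\<close> are positive, so that all transforms are finite.\<close>
  define r where "r = 1 / (R + 1)"
  have "R \<ge> 0" by (simp add: R_def)
  then have "r > 0" by (simp add: r_def)
  have pos: "1 + t * u > 0" if "\<bar>t\<bar> < r" "\<bar>u\<bar> \<le> R" for t u
  proof -
    have "\<bar>t * u\<bar> \<le> r * R" unfolding abs_mult using that \<open>r > 0\<close> by (intro mult_mono) auto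
    also have "\<dots> < 1" using \<open>R \<ge> 0\<close> by (simp add: r_def)
    finally show ?thesis by linarith
  qed
  have frac: "(b - a) / ((1 + t * a) * (1 + t * b)) * ((d - c) / ((1 + t * c) * (1 + t * d)))
      = (b' - a') / ((1 + t * a') * (1 + t * b')) * ((d' - c') / ((1 + t * c') * (1 + t * d')))"
    (is "?l = ?r") if t: "\<bar>t\<bar> < r" for t
  proof -
    define e :: "real^2 \<Rightarrow> ennreal" where "e x = ennreal (exp (- (1 * x$1 + t * x$2)))" for x
    have [measurable]: "e \<in> borel_measurable borel"
      unfolding e_def[abs_def] by simp
    have e: "e (x + y) = e x * e y" for x y
      by (simp add: e_def algebra_simps flip: ennreal_mult' exp_add)
    have P: "1 + t * u > 0" if "u \<in> {a, b, c, d, a', b', c', d'}" for u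
      using that t by (intro pos) (auto simp: R_def)
    have I: "(\<integral>\<^sup>+x. e x * indicator (slope_cone u v) x \<partial>lborel)
        = ennreal ((v - u) / ((1 + t * u) * (1 + t * v)))"
      if "u < v" "u \<in> {a, b, c, d, a', b', c', d'}" "v \<in> {a, b, c, d, a', b', c', d'}" for u v
      unfolding e_def by (intro nn_integral_exp_slope_cone that P)
    have N: "0 \<le> (v - u) / ((1 + t * u) * (1 + t * v))"
      if "u < v" "u \<in> {a, b, c, d, a', b', c', d'}" "v \<in> {a, b, c, d, a', b', c', d'}" for u v
      using P[OF that(2)] P[OF that(3)] that(1) by simp
    have "ennreal ?l = (\<integral>\<^sup>+x. e x * overlap (slope_cone a b) (slope_cone c d) x \<partial>lborel)"
      using less by (subst nn_integral_overlap[OF _ _ _ e];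
          simp only: borel_slope_cone I N ennreal_mult insert_iff simp_thms; measurable)
    also have "\<dots> = ennreal ?r"
      unfolding eq
      using less by (subst nn_integral_overlap[OF _ _ _ e];
          simp only: borel_slope_cone I N ennreal_mult insert_iff simp_thms; measurable)
    finally show ?thesis
      using less by (subst (asm) ennreal_inj) (simp_all only: N mult_nonneg_nonneg insert_iff simp_thms)
  qed
  have D: "(b - a) * (d - c) = (b' - a') * (d' - c')"
    using frac[of 0] \<open>r > 0\<close> by simp
  have "{#a, b, c, d#} = {#a', b', c', d'#}"
  proof (rule mset_eqI_prod_linear[OF _ \<open>r > 0\<close>])
    fix t assume t: "\<bar>t\<bar> < r"
    have P: "1 + t * u \<noteq> 0" if "u \<in> {a, b, c, d, a', b', c', d'}" for u
      using that pos[OF t, of u] by (auto simp: R_def)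
    have "(b - a) * (d - c) \<noteq> 0" using less by simp
    moreover have "((b - a) * (d - c)) / ((1 + t * a) * (1 + t * b) * ((1 + t * c) * (1 + t * d)))
      = ((b - a) * (d - c)) / ((1 + t * a') * (1 + t * b') * ((1 + t * c') * (1 + t * d')))"
      using frac[OF t] by (simp only: D times_divide_times_eq)
    ultimately show "(\<Prod>u\<in>#{#a, b, c, d#}. 1 + t * u) = (\<Prod>u\<in>#{#a', b', c', d'#}. 1 + t * u)"
      using P by (simp add: mult.assoc)
  qed simp
  with D show ?thesis by simp
qed

section \<open>Splitting four numbers into two pairs\<close>

lemma add_mset_eq_3D:
  assumes "add_mset a M = {#t, u, v#}"
  shows "a = t \<and> M = {#u, v#} \<or> a = u \<and> M = {#t, v#} \<or> a = v \<and> M = {#t, u#}"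
proof -
  have "a \<in># {#t, u, v#}" by (simp flip: assms)
  moreover have "M = {#u, v#}" if "a = t" using assms that by simp
  moreover have "M = {#t, v#}" if "a = u" using assms that by (simp add: add_mset_commute[of t])
  moreover have "M = {#t, u#}" if "a = v" using assms that
    by (simp add: add_mset_commute[of t v] add_mset_commute[of u v])
  ultimately show ?thesis by auto
qed

lemma add_mset_eq_4D:
  assumes "add_mset a M = {#t, u, v, w#}"
  shows "a = t \<and> M = {#u, v, w#} \<or> a = u \<and> M = {#t, v, w#} \<or>
    a = v \<and> M = {#t, u, w#} \<or> a = w \<and> M = {#t, u, v#}"
proof -
  have "a \<in># {#t, u, v, w#}" by (simp flip: assms)
  moreover have "M = {#u, v, w#}" if "a = t" using assms that by simp
  moreover have "M = {#t, v, w#}" if "a = u" using assms that by (simp add: add_mset_commute[of t u])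
  moreover have "M = {#t, u, w#}" if "a = v" using assms that
    by (simp add: add_mset_commute[of t v] add_mset_commute[of u v])
  moreover have "M = {#t, u, v#}" if "a = w" using assms that
    by (simp add: add_mset_commute[of t w] add_mset_commute[of u w] add_mset_commute[of v w])
  ultimately show ?thesis by auto
qed

text \<open>
  Four ordered numbers can be split into two increasing pairs in three ways.
\<close>

lemma pairing_cases:
  fixes a b c d :: real
  assumes eq: "{#a, b, c, d#} = {#t1, t2, t3, t4#}"
    and t: "t1 \<le> t2" "t2 \<le> t3" "t3 \<le> t4" and less: "a < b" "c < d"
  shows "{(a, b), (c, d)} = {(t1, t2), (t3, t4)} \<or> {(a, b), (c, d)} = {(t1, t3), (t2, t4)} \<or>
     {(a, b), (c, d)} = {(t1, t4), (t2, t3)}"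
proof -
  have 2: "c = x \<and> d = y \<or> c = y \<and> d = x" if "{#c, d#} = {#x, y#}" for x y
    using that by (auto simp: add_eq_conv_ex)
  have 3: "b = x \<and> (c = y \<and> d = z \<or> c = z \<and> d = y) \<or> b = y \<and> (c = x \<and> d = z \<or> c = z \<and> d = x)
      \<or> b = z \<and> (c = x \<and> d = y \<or> c = y \<and> d = x)" if "{#b, c, d#} = {#x, y, z#}" for x y z
    using add_mset_eq_3D[OF that] 2 by blast
  show ?thesis
    using add_mset_eq_4D[OF eq]
  proof (elim disjE conjE)
    assume "a = t1" "{#b, c, d#} = {#t2, t3, t4#}"
    from 3[OF this(2)] this(1) t less show ?thesis
      by (elim disjE conjE) (simp_all add: doubleton_eq_iff)
  next
    assume "a = t2" "{#b, c, d#} = {#t1, t3, t4#}"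
    from 3[OF this(2)] this(1) t less show ?thesis
      by (elim disjE conjE) (simp_all add: doubleton_eq_iff)
  next
    assume "a = t3" "{#b, c, d#} = {#t1, t2, t4#}"
    from 3[OF this(2)] this(1) t less show ?thesis
      by (elim disjE conjE) (simp_all add: doubleton_eq_iff)
  next
    assume "a = t4" "{#b, c, d#} = {#t1, t2, t3#}"
    from 3[OF this(2)] this(1) t less show ?thesis
      by (elim disjE conjE) (simp_all add: doubleton_eq_iff)
  qed
qed

text \<open>
  The products of differences for the three splittings satisfy the Pluecker relation \<open>gap\<close> below,
  in which all terms are nonnegative. Two different splittings can therefore have the same product
  only if some of the numbers coincide and the splittings agree after all, or if they are the
  disjoint splitting \<open>12|34\<close> and the nested splitting \<open>14|23\<close>. The latter is a condition on
  the cross ratio of the four numbers.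
\<close>

lemma pairing_dichotomy:
  fixes a b c d a' b' c' d' :: real
  assumes mset: "{#a, b, c, d#} = {#a', b', c', d'#}"
    and D: "(b - a) * (d - c) = (b' - a') * (d' - c')"
    and less: "a < b" "c < d" "a' < b'" "c' < d'"
  obtains "{(a, b), (c, d)} = {(a', b'), (c', d')}"
  | t1 t2 t3 t4 where "t1 < t2" "t2 < t3" "t3 < t4" "(t2 - t1) * (t4 - t3) = (t4 - t1) * (t3 - t2)"
      "{(a, b), (c, d)} = {(t1, t4), (t2, t3)} \<and> {(a', b'), (c', d')} = {(t1, t2), (t3, t4)}
      \<or> {(a, b), (c, d)} = {(t1, t2), (t3, t4)} \<and> {(a', b'), (c', d')} = {(t1, t4), (t2, t3)}"
proof -
  define l where "l = sorted_list_of_multiset {#a, b, c, d#}"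
  have l: "sorted l" "mset l = {#a, b, c, d#}" by (simp_all add: l_def)
  then have "size (mset l) = 4" by simp
  then obtain t1 t2 t3 t4 where lt: "l = [t1, t2, t3, t4]"
    by (auto simp: numeral_eq_Suc length_Suc_conv)
  then have t: "t1 \<le> t2" "t2 \<le> t3" "t3 \<le> t4" using l by auto
  have m: "{#a, b, c, d#} = {#t1, t2, t3, t4#}" "{#a', b', c', d'#} = {#t1, t2, t3, t4#}"
    using l(2) mset by (simp_all add: lt)
  have gap: "(t3 - t1) * (t4 - t2) = (t2 - t1) * (t4 - t3) + (t4 - t1) * (t3 - t2)"
    by algebra
  have prod: "{(p, q), (r, s)} = {(p', q'), (r', s')} \<Longrightarrow> (q - p) * (s - r) = (q' - p') * (s' - r')"
    for p q r s p' q' r' s' :: real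
    by (auto simp: doubleton_eq_iff)
  note cases = pairing_cases[OF m(1) t less(1,2)] pairing_cases[OF m(2) t less(3,4)]
  show thesis
  proof (cases "{(a, b), (c, d)} = {(a', b'), (c', d')}")
    case True
    then show thesis by (rule that(1))
  next
    case False
    have lt: "t1 < t4"
      using cases(1) less(1,2) t by (elim disjE) (auto simp: doubleton_eq_iff)
    let ?P = "{(t1, t2), (t3, t4)}" and ?Q = "{(t1, t3), (t2, t4)}" and ?R = "{(t1, t4), (t2, t3)}"
    have PQ: "?P = ?Q" if "(t2 - t1) * (t4 - t3) = (t3 - t1) * (t4 - t2)"
      using that gap lt by auto
    have QR: "?Q = ?R" if "(t4 - t1) * (t3 - t2) = (t3 - t1) * (t4 - t2)"
      using that gap by auto
    have PR: "t1 < t2 \<and> t2 < t3 \<and> t3 < t4" if "{(p, q), (r, s)} = ?P" "{(p', q'), (r', s')} = ?R"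
      "p < q" "r < s" "p' < q'" "r' < s'" for p q r s p' q' r' s'
      using that by (auto simp: doubleton_eq_iff)
    have "{(a, b), (c, d)} = ?P \<and> {(a', b'), (c', d')} = ?R \<or>
        {(a, b), (c, d)} = ?R \<and> {(a', b'), (c', d')} = ?P"
      using cases PQ QR D False prod[of a b c d] prod[of a' b' c' d'] by metis
    then show thesis
    proof (elim disjE conjE)
      assume 1: "{(a, b), (c, d)} = ?P" "{(a', b'), (c', d')} = ?R"
      show thesis
      proof (rule that(2)[of t1 t2 t3 t4])
        show "(t2 - t1) * (t4 - t3) = (t4 - t1) * (t3 - t2)"
          using prod[OF 1(1)] prod[OF 1(2)] D by simp
      qed (use PR[OF 1 less] 1 in simp_all)
    next
      assume 1: "{(a, b), (c, d)} = ?R" "{(a', b'), (c', d')} = ?P"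
      show thesis
      proof (rule that(2)[of t1 t2 t3 t4])
        show "(t2 - t1) * (t4 - t3) = (t4 - t1) * (t3 - t2)"
          using prod[OF 1(1)] prod[OF 1(2)] D by simp
      qed (use PR[OF 1(2,1) less(3,4,1,2)] 1 in simp_all)
    qed
  qed
qed

section \<open>Recovering the cones\<close>

lemma pointed_closed_convex_cone_props:
  assumes "pointed_closed_convex_cone A"
  shows "convex_cone A" "closed A" "convex A" "0 \<in> A" "convex (A - {0})"
    "\<And>x c. x \<in> A \<Longrightarrow> 0 \<le> c \<Longrightarrow> c *\<^sub>R x \<in> A"
  using assms extreme_point_of_stillconvex[of A 0]
  by (auto simp: pointed_closed_convex_cone_def convex_cone_def conic_def)

text \<open>
  Two pointed cones that meet only in the origin can be strictly separated, uniformly in the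
  direction: the convex hull of the unit vectors in \<open>A \<union> -B\<close> is compact and omits the origin.
\<close>

lemma strictly_positive_functional:
  assumes A: "pointed_closed_convex_cone A" "interior A \<noteq> {}"
    and B: "pointed_closed_convex_cone B" "interior B \<noteq> {}"
    and AB: "A \<inter> B = {0}"
  obtains \<xi> \<delta> where "\<xi> \<noteq> 0" "\<delta> > 0" "A \<union> uminus ` B \<subseteq> {x. \<delta> * norm x \<le> \<xi> \<bullet> x}"
proof -
  note Ap = pointed_closed_convex_cone_props[OF A(1)]
  note Bp = pointed_closed_convex_cone_props[OF B(1)]
  let ?C = "uminus ` B"
  have ne: "A - {0} \<noteq> {}" "uminus ` (B - {0}) \<noteq> {}"
    using A(2) B(2)
    by (metis interior_singleton subset_singletonD interior_empty Diff_eq_empty_iff image_is_empty)+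
  have cone: "c *\<^sub>R x \<in> A \<union> ?C" if "x \<in> A \<union> ?C" "0 \<le> c" for x c
    using that Ap(6) Bp(6) by (auto simp: image_iff)
  define K where "K = convex hull ((A \<union> ?C) \<inter> sphere 0 1)"
  have "closed (A \<union> ?C)"
    using Ap(2) closed_negations[OF Bp(2)] by blast
  then have "compact ((A \<union> ?C) \<inter> sphere 0 1)"
    by (simp add: closed_Int_compact)
  then have "compact K"
    unfolding K_def by (rule compact_convex_hull)
  have "K \<subseteq> convex hull ((A - {0}) \<union> uminus ` (B - {0}))"
    unfolding K_def by (rule hull_mono) auto
  moreover have "0 \<notin> convex hull ((A - {0}) \<union> uminus ` (B - {0}))"
  proof
    assume "0 \<in> convex hull ((A - {0}) \<union> uminus ` (B - {0}))"
    then obtain u v a c where uv: "0 \<le> u" "0 \<le> v" "u + v = 1" "0 = u *\<^sub>R a + v *\<^sub>R c"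
      and ac: "a \<in> A - {0}" "c \<in> uminus ` (B - {0})"
      unfolding convex_hull_union_two[OF Ap(5) ne(1) convex_negations[OF Bp(5)] ne(2)] by blast
    obtain b where "c = - b" and ab: "a \<in> A - {0}" "b \<in> B - {0}"
      using ac by blast
    then have "u *\<^sub>R a = v *\<^sub>R b" using uv(4) by simp
    then have "u *\<^sub>R a \<in> A \<inter> B" "v *\<^sub>R b \<in> A \<inter> B"
      using Ap(6)[of a u] Bp(6)[of b v] uv ab by auto
    then show False using uv ab AB by auto
  qed
  ultimately have "0 \<notin> K" by blast
  then obtain \<xi> \<delta> where \<xi>: "\<xi> \<noteq> 0" "0 < \<delta>" "\<forall>x\<in>K. \<delta> < \<xi> \<bullet> x"
    using separating_hyperplane_closed_0[of K] \<open>compact K\<close> compact_imp_closed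
    unfolding K_def by (metis convex_convex_hull)
  have "\<delta> * norm x \<le> \<xi> \<bullet> x" if x: "x \<in> A \<union> ?C" for x
  proof (cases "x = 0")
    case False
    then have "(1 / norm x) *\<^sub>R x \<in> K"
      unfolding K_def using cone[OF x, of "1 / norm x"] by (intro hull_inc) simp
    then have "\<delta> < \<xi> \<bullet> ((1 / norm x) *\<^sub>R x)" using \<xi> by blast
    then show ?thesis using False by (simp add: field_simps)
  qed simp
  then show thesis using \<xi> that by blast
qed

text \<open>
  The convolution is positive on the interior of \<open>A'\<close>, and it vanishes outside \<open>A + C\<close>. A closed
  convex cone that contains \<open>A\<close> and \<open>C\<close>, such as the one below, thus contains \<open>A'\<close> as well.
\<close>

lemma cone_subset_support:
  assumes A': "closed A'" "convex_cone A'" "interior A' \<noteq> {}"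
    and C': "closed C'" "convex_cone C'" "interior C' \<noteq> {}"
    and AC: "A \<union> C \<subseteq> {x. \<delta> * norm x \<le> \<xi> \<bullet> x}" and "0 < \<delta>"
    and eq: "overlap A' C' = overlap A C"
  shows "A' \<subseteq> {x. \<delta> * norm x \<le> \<xi> \<bullet> x}" (is "_ \<subseteq> ?K")
proof -
  have "interior A' \<subseteq> ?K"
  proof
    fix x assume "x \<in> interior A'"
    then have "overlap A C x > 0"
      using overlap_pos[of A' C' x] A' C' eq by (metis borel_closed)
    then have "{y. y \<in> A \<and> x - y \<in> C} \<noteq> {}"
      unfolding overlap_def by (metis emeasure_empty less_irrefl)
    then obtain y where "y \<in> A" "x - y \<in> C" by auto
    then have "\<delta> * norm y \<le> \<xi> \<bullet> y" "\<delta> * norm (x - y) \<le> \<xi> \<bullet> (x - y)"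
      using AC by auto
    then have "\<delta> * (norm y + norm (x - y)) \<le> \<xi> \<bullet> x"
      by (simp add: algebra_simps inner_diff_right)
    moreover have "norm x \<le> norm y + norm (x - y)"
      using norm_triangle_ineq[of y "x - y"] by simp
    ultimately show "x \<in> ?K"
      using \<open>0 < \<delta>\<close> by (auto intro: order_trans[OF mult_left_mono])
  qed
  moreover have "closed ?K"
    by (intro closed_Collect_le continuous_intros)
  ultimately have "closure (interior A') \<subseteq> ?K"
    by (rule closure_minimal)
  then show ?thesis
    using convex_closure_interior[of A'] A' by (simp add: convex_cone_def)
qed

text \<open>
  The slopes of a closed convex cone that lies in the open right half plane, apart from its apex,
  form a compact interval.
\<close>

lemma slope_cone_ex:
  assumes S: "closed S" "convex_cone S" "interior S \<noteq> {}"
    and k: "0 < k" and pos: "\<And>x. x \<in> S \<Longrightarrow> norm x \<le> k * x$1"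
  obtains a b where "a < b" "S = slope_cone a b"
proof -
  have scale: "c *\<^sub>R x \<in> S" if "x \<in> S" "0 \<le> c" for c x
    using S(2) that by (simp add: convex_cone_scaleR)
  define I where "I = {t. vector [1, t] \<in> S}"
  have vec: "vector [1, t] = axis 1 1 + t *\<^sub>R (axis 2 1 :: real^2)" for t
    by (simp add: vec_eq_iff forall_2 axis_def)
  have "closed I"
    unfolding I_def vec by (rule continuous_closed_vimage[unfolded vimage_def, OF S(1)]) (intro continuous_intros)
  moreover have "bounded I"
  proof (rule boundedI[of _ k])
    fix t assume "t \<in> I"
    then have "norm (vector [1, t] :: real^2) \<le> k" using pos by (fastforce simp: I_def)
    then show "norm t \<le> k" using component_le_norm_cart[of "vector [1, t] :: real^2" 2] by simp
  qed
  moreover have "convex I"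
  proof (rule convexI)
    fix s t u v :: real assume "s \<in> I" "t \<in> I" "0 \<le> u" "0 \<le> v" "u + v = 1"
    then have "u *\<^sub>R vector [1, s] + v *\<^sub>R vector [1, t] \<in> S"
      using S(2) by (auto simp: I_def convex_cone_def convex_def)
    also have "u *\<^sub>R vector [1, s] + v *\<^sub>R vector [1, t] = (vector [1, u *\<^sub>R s + v *\<^sub>R t] :: real^2)"
      using \<open>u + v = 1\<close> by (simp add: vec_eq_iff forall_2)
    finally show "u *\<^sub>R s + v *\<^sub>R t \<in> I" by (simp add: I_def)
  qed
  ultimately obtain a b where I: "I = {a..b}"
    using connected_compact_interval_1[of I] convex_connected compact_eq_bounded_closed by blast
  have x1: "x$1 > 0" if "x \<in> S" "x \<noteq> 0" for x
    using pos[OF that(1)] that(2) k by (metis less_le_trans zero_less_mult_pos zero_less_norm_iff)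
  have mem: "x \<in> S \<longleftrightarrow> x$2 / x$1 \<in> I" if "x$1 > 0" for x
  proof -
    have "x = x$1 *\<^sub>R vector [1, x$2 / x$1]" "vector [1, x$2 / x$1] = (1 / x$1) *\<^sub>R x"
      using that by (simp_all add: vec_eq_iff forall_2)
    then show ?thesis
      using that scale[of x "1 / x$1"] scale[of "vector [1, x$2 / x$1]" "x$1"] by (auto simp: I_def)
  qed
  \<comment> \<open>An interior point and its vertical translate have different slopes, whence \<open>a < b\<close>.\<close>
  obtain p e where p: "0 < e" "ball p e \<subseteq> S"
    using S(3) by (auto simp: mem_interior)
  define q where "q s = p + s *\<^sub>R (axis 2 1 :: real^2)" for s
  have q: "q s \<in> S" if "\<bar>s\<bar> < e" for s
    using that p by (auto simp: q_def dist_norm subset_iff)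
  have q12: "q s $ 1 = p $ 1" "q s $ 2 = p $ 2 + s" for s
    by (simp_all add: q_def axis_def)
  have "p $ 1 > 0"
    using x1[OF q[of 0]] x1[OF q[of "e / 2"]] p(1) q12
      by (metis abs_of_pos abs_zero add_cancel_left_right half_gt_zero
      field_sum_of_halves less_add_same_cancel1 less_irrefl zero_index)
  then have "p$2 / p$1 \<in> I" "(p$2 + e / 2) / p$1 \<in> I"
    using mem[of "q 0"] mem[of "q (e / 2)"] q[of 0] q[of "e / 2"] p(1) by (simp_all add: q12)
  moreover have "p$2 / p$1 < (p$2 + e / 2) / p$1"
    using \<open>p $ 1 > 0\<close> p(1) by (simp add: divide_strict_right_mono)
  ultimately have ab: "a < b" by (auto simp: I)
  have "S = slope_cone a b"
  proof (intro equalityI subsetI)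
    fix x assume "x \<in> S"
    then show "x \<in> slope_cone a b"
      using mem[OF x1, of x] x1[of x] by (cases "x = 0") (auto simp: I slope_cone_def field_simps)
  next
    fix x assume x: "x \<in> slope_cone a b"
    then have "0 \<le> (b - a) * x$1" by (simp add: slope_cone_def algebra_simps)
    then have "0 \<le> x$1" using ab by (simp add: zero_le_mult_iff)
    then consider "x$1 > 0" | "x = 0"
      using x by (auto simp: slope_cone_def vec_eq_iff forall_2 le_less)
    then show "x \<in> S"
    proof cases
      case 1
      then show ?thesis using x mem[OF 1] by (simp add: I slope_cone_def field_simps)
    next
      case 2
      then show ?thesis using convex_cone_contains_0[OF S(2)] by simp
    qed
  qed
  with ab show thesis by (rule that)
qed

text \<open>
  The cross ratio condition makes it possible to map the four rays of slopes \<open>t1, \<dots>, t4\<close> to the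
  rays at the angles \<open>0\<close>, \<open>pi / 4\<close>, \<open>pi / 2\<close>, \<open>3 * pi / 4\<close>.
\<close>

lemma slope_cone_to_model:
  assumes t: "t1 < t2" "t2 < t3" "t3 < t4"
    and harm: "(t2 - t1) * (t4 - t3) = (t4 - t1) * (t3 - t2)"
  obtains T where "linear T"
    "T ` slope_cone t1 t4 = cone_A 1" "T ` slope_cone t2 t3 = uminus ` cone_B 1"
    "T ` slope_cone t1 t2 = cone_A 2" "T ` slope_cone t3 t4 = uminus ` cone_B 2"
proof -
  \<comment> \<open>Any \<open>\<alpha>, \<beta> > 0\<close> send the slopes \<open>t1\<close> and \<open>t3\<close> to the axes. The ratio is chosen such that \<open>t2\<close>
    goes to the diagonal; by the hypothesis \<open>harm\<close>, \<open>t4\<close> then goes to the antidiagonal.\<close>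
  define \<alpha> \<beta> where "\<alpha> = t2 - t1" and "\<beta> = t3 - t2"
  let ?T = "plane_map (\<alpha> * t3) (- \<alpha>) (- (\<beta> * t1)) \<beta>"
  have pos: "0 < \<alpha>" "0 < \<beta>" using t by (simp_all add: \<alpha>_def \<beta>_def)
  have h: "\<alpha> * (t4 - t3) = \<beta> * (t4 - t1)" using harm by (simp add: \<alpha>_def \<beta>_def mult.commute)
  have "\<beta> * (t4 - t3) < \<beta> * (t4 - t1)" using pos t by simp
  then have "\<beta> * (t4 - t3) < \<alpha> * (t4 - t3)" using h by simp
  then have "\<beta> < \<alpha>" using t by (simp add: mult_less_cancel_right)
  have c1: "?T x $ 1 = \<alpha> * (t3 * x$1 - x$2)" for x by (simp add: algebra_simps)
  have c2: "?T x $ 2 = \<beta> * (x$2 - t1 * x$1)" for x by (simp add: algebra_simps)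
  have diff: "?T x $ 1 - ?T x $ 2 = (\<alpha> + \<beta>) * (t2 * x$1 - x$2)" for x
    unfolding c1 c2 by (simp add: \<alpha>_def \<beta>_def algebra_simps)
  have sum: "?T x $ 1 + ?T x $ 2 = (\<alpha> - \<beta>) * (t4 * x$1 - x$2)" for x
    unfolding c1 c2 using h by algebra
  have s1: "0 \<le> ?T x $ 1 \<longleftrightarrow> x$2 \<le> t3 * x$1" "?T x $ 1 \<le> 0 \<longleftrightarrow> t3 * x$1 \<le> x$2" for x
    unfolding c1 using pos by (auto simp: zero_le_mult_iff mult_le_0_iff)
  have s2: "0 \<le> ?T x $ 2 \<longleftrightarrow> t1 * x$1 \<le> x$2" for x
    unfolding c2 using pos by (auto simp: zero_le_mult_iff)
  have s3: "?T x $ 2 \<le> ?T x $ 1 \<longleftrightarrow> x$2 \<le> t2 * x$1" "?T x $ 1 \<le> ?T x $ 2 \<longleftrightarrow> t2 * x$1 \<le> x$2" for x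
  proof -
    have "?T x $ 2 \<le> ?T x $ 1 \<longleftrightarrow> 0 \<le> (\<alpha> + \<beta>) * (t2 * x$1 - x$2)"
      "?T x $ 1 \<le> ?T x $ 2 \<longleftrightarrow> (\<alpha> + \<beta>) * (t2 * x$1 - x$2) \<le> 0"
      unfolding diff[symmetric] by linarith+
    then show "?T x $ 2 \<le> ?T x $ 1 \<longleftrightarrow> x$2 \<le> t2 * x$1"
      "?T x $ 1 \<le> ?T x $ 2 \<longleftrightarrow> t2 * x$1 \<le> x$2"
      using pos by (auto simp: zero_le_mult_iff mult_le_0_iff)
  qed
  have s4: "0 \<le> ?T x $ 1 + ?T x $ 2 \<longleftrightarrow> x$2 \<le> t4 * x$1" for x
    unfolding sum using \<open>\<beta> < \<alpha>\<close> by (auto simp: zero_le_mult_iff)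
  have "det (matrix ?T) = \<alpha> * \<beta> * (t3 - t1)"
    unfolding det_plane_map by (simp add: algebra_simps)
  then have "surj ?T"
    using pos t linear_injective_imp_surjective[OF linear_plane_map] det_nz_iff_inj[OF linear_plane_map]
    by (metis diff_gt_0_iff_gt less_irrefl less_trans mult_pos_pos)
  then have img: "?T ` slope_cone u v = Q" if "?T -` Q = slope_cone u v" for u v Q
    using that by (metis surj_image_vimage_eq)
  show thesis
  proof (rule that[OF linear_plane_map])
    show "?T ` slope_cone t1 t4 = cone_A 1" "?T ` slope_cone t2 t3 = uminus ` cone_B 1"
      "?T ` slope_cone t1 t2 = cone_A 2" "?T ` slope_cone t3 t4 = uminus ` cone_B 2"
      by (rule img; unfold cone_AB slope_cone_def vimage_Collect_eq s1 s2 s3 s4; blast)+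
  qed
qed

lemma cones_of_overlap:
  assumes A: "pointed_closed_convex_cone A" "interior A \<noteq> {}"
    and B: "pointed_closed_convex_cone B" "interior B \<noteq> {}"
    and A': "pointed_closed_convex_cone A'" "interior A' \<noteq> {}"
    and B': "pointed_closed_convex_cone B'" "interior B' \<noteq> {}"
    and AB: "A \<inter> B = {0}" and eq: "overlap A (uminus ` B) = overlap A' (uminus ` B')"
  shows "same_up_to_exchange A B A' B' \<or> exceptional_pairs A B A' B'"
proof -
  define C C' where "C = uminus ` B" and "C' = uminus ` B'"
  have cone: "closed (uminus ` S)" "convex_cone (uminus ` S)" "interior (uminus ` S) \<noteq> {}"
    if "pointed_closed_convex_cone S" "interior S \<noteq> {}" for S
    using that closed_negations[of S] by (auto simp: pointed_closed_convex_cone_def interior_negations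
      intro!: convex_cone_linear_image linear_uminus)
  note cones = pointed_closed_convex_cone_props(2,1)[OF A(1)] A(2) cone[OF B, folded C_def]
    pointed_closed_convex_cone_props(2,1)[OF A'(1)] A'(2) cone[OF B', folded C'_def]
  have b: "A \<in> sets borel" "C \<in> sets borel" "A' \<in> sets borel" "C' \<in> sets borel"
    using cones by (auto intro: borel_closed)
  obtain \<xi> \<delta> where \<xi>: "\<xi> \<noteq> 0" "\<delta> > 0" and sub: "A \<union> C \<subseteq> {x. \<delta> * norm x \<le> \<xi> \<bullet> x}"
    using strictly_positive_functional[OF A B AB] unfolding C_def by metis
  have A'sub: "A' \<subseteq> {x. \<delta> * norm x \<le> \<xi> \<bullet> x}"
    by (rule cone_subset_support[OF cones(7-12) sub \<xi>(2)]) (use eq in \<open>simp add: C_def C'_def\<close>)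
  have C'sub: "C' \<subseteq> {x. \<delta> * norm x \<le> \<xi> \<bullet> x}"
    by (rule cone_subset_support[OF cones(10-12,7-9) sub \<xi>(2)])
      (use eq overlap_commute[OF b(3,4)] in \<open>simp add: C_def C'_def\<close>)
  \<comment> \<open>Coordinates in which the separating functional is the first coordinate.\<close>
  let ?h = "plane_map (\<xi>$1) (\<xi>$2) (- \<xi>$2) (\<xi>$1)"
  have h1: "?h x $ 1 = \<xi> \<bullet> x" for x by (simp add: inner_vec_def UNIV_2)
  have "det (matrix ?h) = (\<xi>$1)\<^sup>2 + (\<xi>$2)\<^sup>2" by (simp add: det_plane_map power2_eq_square)
  then have d: "det (matrix ?h) \<noteq> 0"
    using \<xi>(1) by (simp add: vec_eq_iff forall_2 sum_power2_eq_zero_iff)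
  have inj: "inj ?h" using d det_nz_iff_inj[OF linear_plane_map] by blast
  obtain k where k: "k > 0" "\<And>x. norm (?h x) \<le> k * norm x"
    using linear_bounded_pos[OF linear_plane_map] by metis
  have slopes: "\<exists>a b. a < b \<and> ?h ` S = slope_cone a b"
    if "closed S" "convex_cone S" "interior S \<noteq> {}" "S \<subseteq> {x. \<delta> * norm x \<le> \<xi> \<bullet> x}" for S
  proof (rule slope_cone_ex[of "?h ` S" "k / \<delta>"])
    fix y assume "y \<in> ?h ` S"
    then obtain x where x: "x \<in> S" "y = ?h x" by blast
    have "norm y \<le> k * norm x" using k x by simp
    also have "\<dots> \<le> k * (\<xi> \<bullet> x / \<delta>)"
      using x that(4) k(1) \<xi>(2) by (intro mult_left_mono) (auto simp: field_simps)
    finally show "norm y \<le> k / \<delta> * y $ 1" unfolding x(2) h1 by simp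
  qed (use that k(1) \<xi>(2) inj in \<open>auto simp: interior_injective_linear_image closed_injective_linear_image
      convex_cone_linear_image linear_plane_map\<close>)
  obtain a b where ab: "a < b" "?h ` A = slope_cone a b"
    using slopes[OF cones(1-3)] sub by blast
  obtain c d where cd: "c < d" "?h ` C = slope_cone c d"
    using slopes[OF cones(4-6)] sub by blast
  obtain a' b' where ab': "a' < b'" "?h ` A' = slope_cone a' b'"
    using slopes[OF cones(7-9)] A'sub by blast
  obtain c' d' where cd': "c' < d'" "?h ` C' = slope_cone c' d'"
    using slopes[OF cones(10-12)] C'sub by blast
  note imgs = ab(2) cd(2) ab'(2) cd'(2)
  have "overlap (?h ` A) (?h ` C) = overlap (?h ` A') (?h ` C')"
    using eq by (subst overlap_linear_image_eq_iff[OF linear_plane_map d])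
      (simp_all add: imgs flip: C_def C'_def)
  then have invariants: "(b - a) * (d - c) = (b' - a') * (d' - c')" "{#a, b, c, d#} = {#a', b', c', d'#}"
    using slopes_of_overlap[OF ab(1) cd(1) ab'(1) cd'(1)] unfolding imgs by auto
  show ?thesis
  proof (rule pairing_dichotomy[OF invariants(2,1) ab(1) cd(1) ab'(1) cd'(1)])
    assume "{(a, b), (c, d)} = {(a', b'), (c', d')}"
    then have "{?h ` A, ?h ` C} = {?h ` A', ?h ` C'}"
      unfolding imgs by (auto simp: doubleton_eq_iff)
    then have "{A, C} = {A', C'}"
      using inj by (auto simp: doubleton_eq_iff inj_image_eq_iff)
    then show ?thesis by (simp add: same_up_to_exchange_def C_def C'_def)
  next
    fix t1 t2 t3 t4
    assume t: "t1 < t2" "t2 < t3" "t3 < t4" "(t2 - t1) * (t4 - t3) = (t4 - t1) * (t3 - t2)"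
      and pairs: "{(a, b), (c, d)} = {(t1, t4), (t2, t3)} \<and> {(a', b'), (c', d')} = {(t1, t2), (t3, t4)}
        \<or> {(a, b), (c, d)} = {(t1, t2), (t3, t4)} \<and> {(a', b'), (c', d')} = {(t1, t4), (t2, t3)}"
    obtain T where T: "linear T"
      "T ` slope_cone t1 t4 = cone_A 1" "T ` slope_cone t2 t3 = uminus ` cone_B 1"
      "T ` slope_cone t1 t2 = cone_A 2" "T ` slope_cone t3 t4 = uminus ` cone_B 2"
      using slope_cone_to_model[OF t] by metis
    define F where "F = (\<lambda>(u, v). T ` slope_cone u v)"
    define U where "U = T \<circ> ?h"
    have U: "linear U" unfolding U_def by (intro linear_compose linear_plane_map T(1))
    have neg: "U ` uminus ` S = uminus ` (U ` S)" for S
      by (simp add: image_image linear_neg[OF U])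
    have U_image: "U ` S = T ` (?h ` S)" for S
      by (simp add: U_def image_comp)
    have F: "{U ` A, U ` C} = F ` {(a, b), (c, d)}" "{U ` A', U ` C'} = F ` {(a', b'), (c', d')}"
      by (simp_all add: F_def U_image imgs)
    have F1: "F ` {(t1, t4), (t2, t3)} = {cone_A 1, uminus ` cone_B 1}"
      and F2: "F ` {(t1, t2), (t3, t4)} = {cone_A 2, uminus ` cone_B 2}"
      using T by (simp_all add: F_def)
    have "exceptional_pairs A B A' B'"
      unfolding exceptional_pairs_def
    proof (intro exI[of _ U])
      show "\<exists>i j. linear U \<and> i \<in> {1, 2} \<and> j \<in> {1, 2} \<and> i \<noteq> j \<and>
        {U ` A, uminus ` U ` B} = {cone_A i, uminus ` cone_B i} \<and>
        {U ` A', uminus ` U ` B'} = {cone_A j, uminus ` cone_B j}"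
        using pairs
      proof (elim disjE conjE)
        assume "{(a, b), (c, d)} = {(t1, t4), (t2, t3)}" "{(a', b'), (c', d')} = {(t1, t2), (t3, t4)}"
        then have "{U ` A, U ` C} = {cone_A 1, uminus ` cone_B 1}"
          "{U ` A', U ` C'} = {cone_A 2, uminus ` cone_B 2}"
          unfolding F by (simp_all only: F1 F2)
        then show ?thesis
          unfolding C_def C'_def neg using U by (intro exI[of _ 1] exI[of _ 2]) simp
      next
        assume "{(a, b), (c, d)} = {(t1, t2), (t3, t4)}" "{(a', b'), (c', d')} = {(t1, t4), (t2, t3)}"
        then have "{U ` A, U ` C} = {cone_A 2, uminus ` cone_B 2}"
          "{U ` A', U ` C'} = {cone_A 1, uminus ` cone_B 1}"
          unfolding F by (simp_all only: F1 F2)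
        then show ?thesis
          unfolding C_def C'_def neg using U by (intro exI[of _ 2] exI[of _ 1]) simp
      qed
    qed
    then show ?thesis ..
  qed
qed

theorem theorem1p3:
  fixes A B A' B' :: "(real^2) set"
  assumes "pointed_closed_convex_cone A" and "interior A \<noteq> {}"
    and "pointed_closed_convex_cone B" and "interior B \<noteq> {}"
    and "pointed_closed_convex_cone A'" and "interior A' \<noteq> {}"
    and "pointed_closed_convex_cone B'" and "interior B' \<noteq> {}"
    and "interior A \<inter> interior B = {}"
  shows "(same_up_to_exchange A B A' B' \<or> exceptional_pairs A B A' B' \<longrightarrow>
            cross_covariogram A B = cross_covariogram A' B') \<and>
         (A \<inter> B = {0} \<longrightarrow> cross_covariogram A B = cross_covariogram A' B' \<longrightarrow>
            same_up_to_exchange A B A' B' \<or> exceptional_pairs A B A' B')"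
proof -
  have closed: "closed A" "closed (uminus ` B)" "closed A'" "closed (uminus ` B')"
    using assms(1,3,5,7) by (auto simp: pointed_closed_convex_cone_def closed_negations)
  note borel = closed[THEN borel_closed]
  have iff: "cross_covariogram A B = cross_covariogram A' B' \<longleftrightarrow>
      overlap A (uminus ` B) = overlap A' (uminus ` B')"
    by (rule cross_covariogram_eq_iff[OF borel(1,3,2,4)])
  have "overlap A (uminus ` B) = overlap A' (uminus ` B')" if "same_up_to_exchange A B A' B'"
    using that overlap_doubleton[OF _ borel(1,2)] by (simp add: same_up_to_exchange_def)
  moreover have "overlap A (uminus ` B) = overlap A' (uminus ` B')" if ex: "exceptional_pairs A B A' B'"
  proof -
    obtain T i j where T: "linear T" "i \<in> {1, 2}" "j \<in> {1, 2}" "i \<noteq> j"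
      "{T ` A, uminus ` (T ` B)} = {cone_A i, uminus ` cone_B i}"
      "{T ` A', uminus ` (T ` B')} = {cone_A j, uminus ` cone_B j}"
      using ex unfolding exceptional_pairs_def by metis
    have "uminus ` (T ` S) = T ` uminus ` S" for S
      by (simp add: image_image linear_neg[OF T(1)])
    with T show ?thesis
      using overlap_eq_if_exceptional[OF T(1-4)] by simp
  qed
  ultimately show ?thesis
    unfolding iff using cones_of_overlap[OF assms(1-8)] by blast
qed

end
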